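(* Let $(a_n)_{n\ge1}$ be a sequence of positive integers, $n\ge1$, and let $x_0,x_n$ be integers with $2^{b_n}x_n-3^nx_0=B_n$, $1\le x_0<2^{b_n}$, $1\le x_n<3^n$ and $3\nmid x_0$. Define $x_k=\frac{3x_{k-1}+1}{2^{a_k}}$ for $1\le k\le n-1$, and suppose $x_0,\dots,x_{n-1}$ are distinct integers. Then $x_0>\frac{B_n}{3^n(1.5\,n^{1/9}-1)}$.
   Context: For a sequence $(a_n)_{n\ge1}$ of positive integers: $b_0=0$, $b_n=\sum_{i=1}^n a_i$, and $B_n=\sum_{i=0}^{n-1}3^{n-1-i}2^{b_i}$. *)

theory Defs
  imports Complex_Main
begin

text \<open>The sequences are indexed from 1, so the value \<open>a 0\<close> is never used.\<close>

definition b :: "(nat \<Rightarrow> nat) \<Rightarrow> nat \<Rightarrow> nat" where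
  "b a n = (\<Sum>i=1..n. a i)"

definition B :: "(nat \<Rightarrow> nat) \<Rightarrow> nat \<Rightarrow> nat" where
  "B a n = (\<Sum>i<n. 3 ^ (n - 1 - i) * 2 ^ b a i)"

end

theory Submission
  imports Defs
begin

text \<open>
  Multiplying the steps \<open>2 ^ a k * x k = 3 * x (k - 1) + 1\<close> gives
  \<open>1 + B a n / (3 ^ n * x 0) = (\<Prod>i<n. 1 + 1 / (3 * x i))\<close>. The \<open>x i\<close> with \<open>i < n\<close> are distinct
  positive integers prime to 6, hence the numbers \<open>x i div 3\<close> are distinct as well, and the product
  is at most \<open>\<Prod>k<n. 1 + 1 / (9 * k + 3)\<close>. By Bernoulli's inequality the ninth power of the factor
  with index \<open>k \<ge> 1\<close> is at most \<open>(9 * k + 4) / (9 * k - 5)\<close>, so the ninth power of the product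
  telescopes to at most \<open>(4 / 3) ^ 9 * (9 * n - 5) / 4 < 1.5 ^ 9 * n\<close>.
\<close>

text \<open>Elements are inserted in increasing order: a new maximum \<open>m\<close> is at least
  the number of elements below it, so its factor \<open>f m\<close> is at most
  \<open>f (card Y)\<close>.\<close>

lemma prod_antimono_le_prod_lessThan_card:
  fixes f :: "nat \<Rightarrow> real"
  assumes "finite Y" and anti: "antimono f" and nonneg: "\<And>k. 0 \<le> f k"
  shows "(\<Prod>y\<in>Y. f y) \<le> (\<Prod>k<card Y. f k)"
  using \<open>finite Y\<close>
proof (induction rule: finite_linorder_max_induct)
  case empty
  then show ?case by simp
next
  case (insert m Y)
  have "Y \<subseteq> {..<m}" using insert.hyps by auto
  then have "card Y \<le> m" using card_mono[of "{..<m}" Y] by simp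
  then have "f m \<le> f (card Y)" using anti by (simp add: antimonoD)
  moreover have "m \<notin> Y" using insert.hyps by auto
  ultimately show ?case
    using insert nonneg by (simp add: mult_mono prod_nonneg mult.commute)
qed

text \<open>Bernoulli is applied to the reciprocal \<open>1 - 1 / c\<close> of the base. The bound
  has this form so that it telescopes when \<open>c\<close> advances in steps of
  \<open>p\<close>.\<close>

lemma one_plus_inverse_power_le:
  fixes c :: real
  assumes "c > real p" and "p \<ge> 1"
  shows "(1 + 1 / (c - 1)) ^ p \<le> c / (c - real p)"
proof -
  have c: "c > 1" using assms by linarith
  have "1 + real p * (- 1 / c) \<le> (1 + (- 1 / c)) ^ p"
    using c by (intro Bernoulli_inequality) (simp add: field_simps)
  then have "(c - real p) / c \<le> ((c - 1) / c) ^ p"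
    using c by (simp add: field_simps)
  then have "1 / ((c - 1) / c) ^ p \<le> 1 / ((c - real p) / c)"
    using assms c by (intro divide_left_mono mult_pos_pos divide_pos_pos zero_less_power) auto
  moreover have "1 + 1 / (c - 1) = 1 / ((c - 1) / c)"
    using c by (simp add: field_simps)
  ultimately show ?thesis by (simp add: power_divide)
qed

text \<open>The factor with \<open>k = 0\<close> stays exact as \<open>4 / 3\<close>: there
  \<open>c\<close> would be 4, and the Bernoulli bound needs \<open>c > 9\<close>.\<close>

lemma prod_nine_power_le:
  "(\<Prod>k<Suc n. 1 + 1 / (9 * real k + 3)) ^ 9 \<le> (4 / 3) ^ 9 * (9 * real n + 4) / 4"
proof (induction n)
  case 0
  then show ?case by simp
next
  case (Suc n)
  let ?P = "\<Prod>k<Suc n. 1 + 1 / (9 * real k + 3)"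
  have "(1 + 1 / (9 * real (Suc n) + 3)) ^ 9 \<le> (9 * real n + 13) / (9 * real n + 4)"
    using one_plus_inverse_power_le[of 9 "9 * real n + 13"] by (simp add: algebra_simps)
  then have "?P ^ 9 * (1 + 1 / (9 * real (Suc n) + 3)) ^ 9 \<le>
      ((4 / 3) ^ 9 * (9 * real n + 4) / 4) * ((9 * real n + 13) / (9 * real n + 4))"
    by (intro mult_mono Suc) auto
  also have "\<dots> = (4 / 3) ^ 9 * (9 * real (Suc n) + 4) / 4"
    by (simp add: divide_simps add_pos_nonneg) (simp add: algebra_simps)
  finally show ?case by (simp only: prod.lessThan_Suc[of _ "Suc n"] power_mult_distrib)
qed

lemma prod_less_powr:
  assumes "n \<ge> 1"
  shows "(\<Prod>k<n. 1 + 1 / (9 * real k + 3)) < 1.5 * real n powr (1 / 9)"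
proof -
  obtain m where m: "n = Suc m" using assms by (cases n) auto
  have "(\<Prod>k<n. 1 + 1 / (9 * real k + 3)) ^ 9 \<le> (4 / 3) ^ 9 * (9 * real m + 4) / 4"
    unfolding m by (rule prod_nine_power_le)
  \<comment> \<open>Since \<open>9 * m + 4 < 9 * n\<close>, it is enough that
    \<open>(4 / 3) ^ 9 * 9 / 4\<close>, about 29.97, is below \<open>1.5 ^ 9\<close>, about
    38.44.\<close>
  also have "\<dots> < 1.5 ^ 9 * real n"
    unfolding m by (simp add: field_simps)
  also have "\<dots> = (1.5 * real n powr (1 / 9)) ^ 9"
    using assms by (simp only: power_mult_distrib) (simp add: powr_power)
  finally show ?thesis
    by (rule power_less_imp_less_base) simp
qed

text \<open>For a given quotient \<open>q\<close> the candidates prime to 3 are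
  \<open>3 * q + 1\<close> and \<open>3 * q + 2\<close>, and exactly one of these neighbours is
  odd.\<close>

lemma inj_on_div_3_coprime_6:
  "inj_on (\<lambda>z. nat (z div 3)) {z :: int. 0 < z \<and> odd z \<and> \<not> 3 dvd z}"
proof (rule inj_onI)
  fix y z :: int
  assume y: "y \<in> {z. 0 < z \<and> odd z \<and> \<not> 3 dvd z}" and z: "z \<in> {z. 0 < z \<and> odd z \<and> \<not> 3 dvd z}"
    and "nat (y div 3) = nat (z div 3)"
  then have "y div 3 = z div 3" by (simp add: nat_eq_iff pos_imp_zdiv_nonneg_iff split: if_splits)
  moreover have "odd y" "odd z" "\<not> 3 dvd y" "\<not> 3 dvd z" using y z by auto
  ultimately show "y = z" by presburger
qed

lemma prod_coprime_6_less_powr: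
  fixes x :: "nat \<Rightarrow> int"
  assumes n: "n \<ge> 1" and inj: "inj_on x {..<n}"
    and x: "\<And>i. i < n \<Longrightarrow> 0 < x i \<and> odd (x i) \<and> \<not> 3 dvd x i"
  shows "(\<Prod>i<n. 1 + 1 / (3 * real_of_int (x i))) < 1.5 * real n powr (1 / 9)"
proof -
  define y where "y i = nat (x i div 3)" for i
  define f where "f k = 1 + 1 / (9 * real k + 3)" for k :: nat
  have "inj_on (\<lambda>z. nat (z div 3)) (x ` {..<n})"
    by (rule inj_on_subset[OF inj_on_div_3_coprime_6]) (use x in auto)
  then have inj_y: "inj_on y {..<n}"
    using comp_inj_on[OF inj] unfolding y_def comp_def by blast
  have "(\<Prod>i<n. 1 + 1 / (3 * real_of_int (x i))) \<le> (\<Prod>i<n. f (y i))"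
  proof (rule prod_mono, rule conjI)
    fix i assume "i \<in> {..<n}"
    then have xi: "0 < x i" "\<not> 3 dvd x i" using x by auto
    then show "0 \<le> 1 + 1 / (3 * real_of_int (x i))" by simp
    \<comment> \<open>The remainder of \<open>x i\<close> modulo 3 is at least 1; this is the source
      of the 3 in the denominator \<open>9 * k + 3\<close>.\<close>
    have "3 * int (y i) + 1 \<le> x i"
      using xi unfolding y_def by (simp add: pos_imp_zdiv_nonneg_iff) presburger
    then have "9 * real (y i) + 3 \<le> 3 * real_of_int (x i)" by linarith
    then show "1 + 1 / (3 * real_of_int (x i)) \<le> f (y i)"
      unfolding f_def by (intro add_left_mono divide_left_mono) (use xi in auto)
  qed
  also have "\<dots> = (\<Prod>k\<in>y ` {..<n}. f k)"
    by (simp add: prod.reindex[OF inj_y])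
  also have "\<dots> \<le> (\<Prod>k<card (y ` {..<n}). f k)"
    by (rule prod_antimono_le_prod_lessThan_card)
      (auto simp: f_def antimono_def intro!: divide_left_mono)
  also have "\<dots> = (\<Prod>k<n. f k)" by (simp add: card_image[OF inj_y])
  also have "\<dots> < 1.5 * real n powr (1 / 9)"
    unfolding f_def by (rule prod_less_powr[OF n])
  finally show ?thesis .
qed

lemma b_Suc: "b a (Suc n) = b a n + a (Suc n)"
  by (simp add: b_def)

lemma B_Suc: "B a (Suc n) = 3 * B a n + 2 ^ b a n"
proof -
  have "(\<Sum>i<n. 3 ^ (n - i) * 2 ^ b a i) = (\<Sum>i<n. 3 * (3 ^ (n - 1 - i) * 2 ^ b a i) :: nat)"
  proof (rule sum.cong)
    fix i assume "i \<in> {..<n}"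
    then have "n - i = Suc (n - 1 - i)" by auto
    then show "3 ^ (n - i) * 2 ^ b a i = (3 * (3 ^ (n - 1 - i) * 2 ^ b a i) :: nat)" by simp
  qed simp
  then show ?thesis by (simp add: B_def sum_distrib_left)
qed

text \<open>Used below for the first \<open>n - 1\<close> steps; comparison with the hypothesis on
  \<open>x n\<close> then yields the last step.\<close>

lemma collatz_iterate_eq:
  fixes x :: "nat \<Rightarrow> int"
  assumes "\<And>i. i < k \<Longrightarrow> 2 ^ a (Suc i) * x (Suc i) = 3 * x i + 1"
  shows "2 ^ b a k * x k = 3 ^ k * x 0 + int (B a k)"
  using assms
proof (induction k)
  case 0
  then show ?case by (simp add: b_def B_def)
next
  case (Suc k)
  have "2 ^ b a (Suc k) * x (Suc k) = 2 ^ b a k * (2 ^ a (Suc k) * x (Suc k))"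
    by (simp add: b_Suc power_add)
  also have "\<dots> = 3 * (2 ^ b a k * x k) + 2 ^ b a k"
    using Suc.prems[of k] by (simp add: algebra_simps)
  also have "\<dots> = 3 ^ Suc k * x 0 + int (B a (Suc k))"
    using Suc by (simp add: B_Suc algebra_simps)
  finally show ?case .
qed

text \<open>Each step is read multiplicatively, as
  \<open>3 * x i + 1 = 3 * x i * (1 + 1 / (3 * x i))\<close>, which requires \<open>x i\<close> to
  be nonzero.\<close>

lemma collatz_iterate_prod:
  fixes x :: "nat \<Rightarrow> int"
  assumes "\<And>i. i < k \<Longrightarrow> 2 ^ a (Suc i) * x (Suc i) = 3 * x i + 1"
    and "\<And>i. i < k \<Longrightarrow> x i \<noteq> 0"
  shows "2 ^ b a k * real_of_int (x k) =
    3 ^ k * real_of_int (x 0) * (\<Prod>i<k. 1 + 1 / (3 * real_of_int (x i)))"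
  using assms
proof (induction k)
  case 0
  then show ?case by (simp add: b_def)
next
  case (Suc k)
  have "real_of_int (2 ^ a (Suc k) * x (Suc k)) = real_of_int (3 * x k + 1)"
    using Suc.prems(1)[of k] by (simp only: lessI)
  then have "2 ^ a (Suc k) * real_of_int (x (Suc k)) =
      3 * real_of_int (x k) * (1 + 1 / (3 * real_of_int (x k)))"
    using Suc.prems(2)[of k] by (simp add: field_simps)
  then have "2 ^ b a (Suc k) * real_of_int (x (Suc k)) =
      (2 ^ b a k * real_of_int (x k)) * (3 * (1 + 1 / (3 * real_of_int (x k))))"
    by (simp add: b_Suc power_add mult_ac)
  also have "\<dots> = 3 ^ k * real_of_int (x 0) * (\<Prod>i<k. 1 + 1 / (3 * real_of_int (x i))) *
      (3 * (1 + 1 / (3 * real_of_int (x k))))"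
    using Suc by simp
  finally show ?case by (simp add: mult_ac)
qed

theorem theorem4p6:
  fixes a :: "nat \<Rightarrow> nat" and n :: nat and x :: "nat \<Rightarrow> int"
  assumes a_pos: "\<And>i. i \<ge> 1 \<Longrightarrow> a i > 0"
    and n: "n \<ge> 1"
    and eq: "2 ^ b a n * x n - 3 ^ n * x 0 = int (B a n)"
    and x0: "1 \<le> x 0" "x 0 < 2 ^ b a n"
    and xn: "1 \<le> x n" "x n < 3 ^ n"
    and ndvd: "\<not> 3 dvd x 0"
    and step: "\<And>k. 1 \<le> k \<Longrightarrow> k \<le> n - 1 \<Longrightarrow>
                 real_of_int (x k) = (3 * real_of_int (x (k - 1)) + 1) / 2 ^ a k"
    and distinct: "inj_on x {0..n - 1}"
  shows "real_of_int (x 0) > real (B a n) / (3 ^ n * (1.5 * real n powr (1 / 9) - 1))"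
proof -
  obtain m where m: "n = Suc m" using n by (cases n) auto
  have step_less: "2 ^ a (Suc i) * x (Suc i) = 3 * x i + 1" if "i < m" for i
  proof -
    have "real_of_int (x (Suc i)) = (3 * real_of_int (x i) + 1) / 2 ^ a (Suc i)"
      using step[of "Suc i"] that m by simp
    then have "real_of_int (2 ^ a (Suc i) * x (Suc i)) = real_of_int (3 * x i + 1)"
      by simp
    then show ?thesis by (simp only: of_int_eq_iff)
  qed
  \<comment> \<open>The last step is not among the hypotheses; it is forced by the equation for \<open>x n\<close>.\<close>
  have "2 ^ b a m * (2 ^ a n * x n) = 2 ^ b a m * (3 * x m + 1)"
    using collatz_iterate_eq[of m a x] step_less eq
    by (simp add: m b_Suc B_Suc power_add algebra_simps)
  then have "2 ^ a n * x n = 3 * x m + 1" by simp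
  with step_less have steps: "2 ^ a (Suc i) * x (Suc i) = 3 * x i + 1" if "i < n" for i
    using that m by (auto simp: less_Suc_eq)
  have pos: "0 < x i" if "i \<le> n" for i
    using that
  proof (induction i)
    case 0
    then show ?case using x0 by simp
  next
    case (Suc i)
    then have "0 < 2 ^ a (Suc i) * x (Suc i)" using steps[of i] by simp
    then show ?case by (simp add: zero_less_mult_iff)
  qed
  have odd: "odd (x i)" if "i < n" for i
  proof -
    \<comment> \<open>Positivity of the exponent makes \<open>3 * x i + 1\<close> even, so
      \<open>x i\<close> is odd.\<close>
    have "even (2 ^ a (Suc i) * x (Suc i))" using a_pos[of "Suc i"] by simp
    then show ?thesis using steps[OF that] by simp
  qed
  have not_3_dvd: "\<not> 3 dvd x i" if "i < n" for i
  proof (cases i)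
    case 0
    then show ?thesis using ndvd by simp
  next
    case (Suc j)
    \<comment> \<open>If 3 divided \<open>x i\<close>, it would divide \<open>2 ^ a i * x i\<close>,
      which is \<open>3 * x j + 1\<close>.\<close>
    have "\<not> 3 dvd (3 * x j + 1)" by presburger
    then show ?thesis using steps[of j] that Suc by (metis Suc_lessD dvd_mult)
  qed
  have set_eq: "{0..n - 1} = {..<n}" using n by auto
  define P where "P = (\<Prod>i<n. 1 + 1 / (3 * real_of_int (x i)))"
  define D where "D = 1.5 * real n powr (1 / 9)"
  have PD: "P < D"
    unfolding P_def D_def
    by (rule prod_coprime_6_less_powr[OF n]) (use distinct set_eq pos odd not_3_dvd in auto)
  \<comment> \<open>This makes \<open>D - 1\<close> positive, as the final division
    requires.\<close>
  have "1 \<le> P" unfolding P_def by (intro prod_ge_1) (simp add: less_imp_le pos)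
  with PD have "1 < D" by simp
  have x0_pos: "0 < real_of_int (x 0)" using x0 by simp
  have "x i \<noteq> 0" if "i < n" for i using pos[of i] that by simp
  then have "2 ^ b a n * real_of_int (x n) = 3 ^ n * real_of_int (x 0) * P"
    unfolding P_def using steps by (intro collatz_iterate_prod) auto
  moreover have "real_of_int (2 ^ b a n * x n - 3 ^ n * x 0) = real (B a n)"
    unfolding eq by simp
  \<comment> \<open>The term \<open>2 ^ b a n * x n\<close> has been evaluated in two ways, as a
    product and as a sum.\<close>
  ultimately have "real (B a n) = 3 ^ n * real_of_int (x 0) * (P - 1)"
    by (simp add: algebra_simps)
  also have "\<dots> < 3 ^ n * real_of_int (x 0) * (D - 1)"
    using PD x0_pos by simp
  finally have "real (B a n) < real_of_int (x 0) * (3 ^ n * (D - 1))"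
    by (simp add: mult_ac)
  then show ?thesis
    using \<open>1 < D\<close> unfolding D_def[symmetric] by (subst pos_divide_less_eq) auto
qed

end
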